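(* If $f$ is a strictly locally 1-to-1 map from an arc-like continuum $X$ onto a continuum $Y$, then $Y$ is a 2-to-1 retract of a continuum.
   Context: A continuum is a (nonempty) connected, compact metric space. A map is a continuous function. For $\epsilon>0$, an $\epsilon$-map is a map all of whose point preimages have diameter less than $\epsilon$. A continuum is arc-like if for each $\epsilon>0$ there is an $\epsilon$-map from it onto an arc (equivalently, onto $[0,1]$). A map is locally 1-to-1 if each point of its domain has a neighborhood on which the map is injective; it is strictly locally 1-to-1 if it is locally 1-to-1 but is not a homeomorphism onto its image. A function is 2-to-1 if the preimage of each point of its image has exactly two points. A continuum $Y$ is a 2-to-1 retract (of a continuum) if there is a continuum $Z$ and a 2-to-1 retraction from $Z$ onto a subcontinuum of $Z$ that is homeomorphic to $Y$. *)

theory Defs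
  imports "HOL-Analysis.Analysis"
begin

definition continuum :: "'a::metric_space set \<Rightarrow> bool" where
  "continuum S \<longleftrightarrow> S \<noteq> {} \<and> compact S \<and> connected S"

definition eps_map :: "real \<Rightarrow> 'a::metric_space set \<Rightarrow> ('a \<Rightarrow> 'b::topological_space) \<Rightarrow> bool" where
  "eps_map e S g \<longleftrightarrow> continuous_on S g \<and> (\<forall>y \<in> g ` S. diameter {x \<in> S. g x = y} < e)"

definition arc_like :: "'a::metric_space set \<Rightarrow> bool" where
  "arc_like S \<longleftrightarrow>
     continuum S \<and> (\<forall>e>0. \<exists>g :: 'a \<Rightarrow> real. eps_map e S g \<and> g ` S = {0..1})"

definition locally_one_to_one_map :: "'a::topological_space set \<Rightarrow> ('a \<Rightarrow> 'b::topological_space) \<Rightarrow> bool" where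
  "locally_one_to_one_map S f \<longleftrightarrow>
     continuous_on S f \<and> (\<forall>x\<in>S. \<exists>U. open U \<and> x \<in> U \<and> inj_on f (S \<inter> U))"

definition strictly_locally_one_to_one_map ::
    "'a::topological_space set \<Rightarrow> ('a \<Rightarrow> 'b::topological_space) \<Rightarrow> bool" where
  "strictly_locally_one_to_one_map S f \<longleftrightarrow>
     locally_one_to_one_map S f \<and> \<not> (\<exists>g. homeomorphism S (f ` S) f g)"

definition two_to_one_on :: "'a set \<Rightarrow> ('a \<Rightarrow> 'b) \<Rightarrow> bool" where
  "two_to_one_on S f \<longleftrightarrow> (\<forall>y \<in> f ` S. card {x \<in> S. f x = y} = 2)"

text \<open>
  A definition cannot quantify over the type of the ambient continuum, so \<open>Z\<close> ranges over
  the continua in \<open>nat \<Rightarrow> real\<close> with the product topology, which contains a copy of every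
  compact metric space.  Lemma \<open>two_to_one_retractI\<close> below shows that a witness
  in an arbitrary metric space type is sufficient, so nothing is lost by this choice.
\<close>

definition two_to_one_retract :: "'b::metric_space set \<Rightarrow> bool" where
  "two_to_one_retract Y \<longleftrightarrow>
     (\<exists>(Z :: (nat \<Rightarrow> real) set) R r.
        continuum Z \<and> continuum R \<and> retraction Z R r \<and> two_to_one_on Z r \<and> R homeomorphic Y)"

lemma compact_homeomorphic_product_real:
  fixes S :: "'a::metric_space set"
  assumes "compact S"
  obtains h :: "'a \<Rightarrow> nat \<Rightarrow> real" and g where "homeomorphism S (h ` S) h g"
proof (cases "S = {}")
  case True
  then have "homeomorphism S ((\<lambda>_. undefined) ` S) (\<lambda>_. undefined :: nat \<Rightarrow> real) undefined"
    by (simp add: homeomorphism_def)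
  then show ?thesis using that by blast
next
  case False
  have "\<forall>n::nat. \<exists>k. finite k \<and> S \<subseteq> (\<Union>x\<in>k. ball x (1 / Suc n))"
  proof
    fix n :: nat
    have "(1::real) / Suc n > 0" by simp
    with assms show "\<exists>k. finite k \<and> S \<subseteq> (\<Union>x\<in>k. ball x (1 / Suc n))"
      unfolding compact_eq_totally_bounded by blast
  qed
  then obtain k where k: "\<And>n::nat. finite (k n)" "\<And>n. S \<subseteq> (\<Union>x\<in>k n. ball x (1 / Suc n))"
    by metis
  define D where "D = (\<Union>n. k n)"
  have D: "countable D" "D \<noteq> {}"
    using k(1) k(2)[of 0] False by (auto simp: D_def countable_finite)
  define h where "h = (\<lambda>x n. dist x (from_nat_into D n))"
  have cont: "continuous_on S h"
    unfolding h_def by (intro continuous_on_coordinatewise_then_product continuous_intros)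
  have "inj_on h S"
  proof (rule inj_onI, rule ccontr)
    fix x y assume xy: "x \<in> S" "y \<in> S" "h x = h y" "x \<noteq> y"
    then have "0 < dist x y / 2" by simp
    then obtain n where n: "1 / Suc n < dist x y / 2"
      by (rule nat_approx_posE)
    from k(2)[of n] xy(1) obtain d where d: "d \<in> k n" "dist d x < 1 / Suc n" by auto
    then have "d \<in> D" by (auto simp: D_def)
    then obtain i where "from_nat_into D i = d"
      using D from_nat_into_surj by metis
    with xy(3) have "dist x d = dist y d" by (auto simp: h_def dest: fun_cong)
    with d(2) n show False
      using dist_triangle2[of x y d] by (simp add: dist_commute)
  qed
  with homeomorphism_compact[OF assms cont refl] that show ?thesis by blast
qed

lemma two_to_one_retractI:
  fixes Z :: "'a::metric_space set" and Y :: "'b::metric_space set"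
  assumes "continuum Z" "continuum R" "retraction Z R r" "two_to_one_on Z r" "R homeomorphic Y"
  shows "two_to_one_retract Y"
proof -
  obtain h :: "'a \<Rightarrow> nat \<Rightarrow> real" and g where hg: "homeomorphism Z (h ` Z) h g"
    using compact_homeomorphic_product_real assms(1) unfolding continuum_def by blast
  have R: "R \<subseteq> Z" "continuous_on Z r" "r ` Z \<subseteq> R" "\<And>x. x \<in> R \<Longrightarrow> r x = x"
    using assms(3) by (auto simp: retraction_def)
  have gh: "\<And>x. x \<in> Z \<Longrightarrow> g (h x) = x" and ch: "continuous_on Z h"
    and cg: "continuous_on (h ` Z) g"
    using hg by (auto simp: homeomorphism_def)
  have img: "continuum (h ` A)" if "continuum A" "A \<subseteq> Z" for A
    using that continuous_on_subset[OF ch]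
    by (auto simp: continuum_def intro: compact_continuous_image connected_continuous_image)
  have "retraction (h ` Z) (h ` R) (h \<circ> r \<circ> g)"
    unfolding retraction_def
  proof (intro conjI)
    have "g ` h ` Z = Z"
      using hg by (simp add: homeomorphism_def)
    moreover have "continuous_on (r ` Z) h"
      by (rule continuous_on_subset[OF ch]) (use R in blast)
    ultimately show "continuous_on (h ` Z) (h \<circ> r \<circ> g)"
      using R(2) by (intro continuous_on_compose cg) (simp_all only: image_comp[symmetric])
    show "h ` R \<subseteq> h ` Z"
      using R(1) by blast
    show "h \<circ> r \<circ> g \<in> h ` Z \<rightarrow> h ` R"
      using R(3) gh by auto
    show "\<forall>x\<in>h ` R. (h \<circ> r \<circ> g) x = x"
      using R(1,4) gh by auto
  qed
  moreover have "two_to_one_on (h ` Z) (h \<circ> r \<circ> g)"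
    unfolding two_to_one_on_def
  proof
    fix y assume "y \<in> (h \<circ> r \<circ> g) ` h ` Z"
    then obtain z where z: "z \<in> Z" "y = h (r z)" using gh by auto
    have rZ: "r x \<in> Z" if "x \<in> Z" for x using R that by auto
    have "{x \<in> h ` Z. (h \<circ> r \<circ> g) x = y} = h ` {x \<in> Z. r x = r z}"
    proof (intro set_eqI iffI)
      fix w assume "w \<in> {x \<in> h ` Z. (h \<circ> r \<circ> g) x = y}"
      then obtain x where x: "x \<in> Z" "w = h x" "h (r (g w)) = y" by auto
      then have "h (r x) = h (r z)" using gh z by simp
      then have "g (h (r x)) = g (h (r z))" by (rule arg_cong)
      then have "r x = r z" using gh rZ x(1) z(1) by simp
      with x show "w \<in> h ` {x \<in> Z. r x = r z}" by blast
    next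
      fix w assume "w \<in> h ` {x \<in> Z. r x = r z}"
      then show "w \<in> {x \<in> h ` Z. (h \<circ> r \<circ> g) x = y}" using gh z by auto
    qed
    moreover have "inj_on h {x \<in> Z. r x = r z}"
      using gh by (intro inj_on_inverseI[where g = g]) simp
    ultimately show "card {x \<in> h ` Z. (h \<circ> r \<circ> g) x = y} = 2"
      using assms(4) z by (simp add: card_image two_to_one_on_def)
  qed
  moreover have "h ` R homeomorphic Y"
  proof -
    have "homeomorphism R (h ` R) h g"
      using homeomorphism_of_subsets[OF hg R(1) _ refl] R(1) by blast
    then have "R homeomorphic h ` R" using homeomorphic_def by blast
    with assms(5) show ?thesis using homeomorphic_sym homeomorphic_trans by blast
  qed
  ultimately show ?thesis
    using img[OF assms(1)] img[OF assms(2) R(1)] unfolding two_to_one_retract_def by blast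
qed

end

theory Submission
  imports Defs
begin

text \<open>
  A 2-to-1 retraction of \<open>Z\<close> onto \<open>Y\<close> amounts to a second copy of the points of \<open>Y\<close>,
  topologised so that \<open>Z\<close> is compact and connected.  Such a copy can be cut out of \<open>X\<close>:
  it is a set \<open>X - K\<close> that meets every point inverse of \<open>f\<close> exactly once.  If \<open>K\<close> is
  closed and nonempty, then attaching \<open>X\<close> to \<open>Y\<close> along \<open>f\<close> restricted to \<open>K\<close> produces a
  continuum \<open>Z\<close>, and \<open>f\<close> together with the identity of \<open>Y\<close> defines the retraction
  (lemma \<open>two_to_one_retract_by_attaching\<close>).

  To find \<open>K\<close>, compactness yields \<open>e > 0\<close> such that distinct points of \<open>X\<close> with the same
  image under \<open>f\<close> are at least \<open>e\<close> apart.  Let \<open>g\<close> be an \<open>e\<close>-map from \<open>X\<close> into the line.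
  It is injective on each point inverse of \<open>f\<close>, hence it orders each of them linearly, and
  each has a first point by compactness.  Take \<open>K\<close> to be the set of points that are not
  first.  It is closed because earlier points with the same image stay at distance at
  least \<open>e\<close> and so cannot disappear in a limit; it is nonempty because \<open>f\<close> is not injective.
\<close>

lemma separated_fibres_if_locally_one_to_one:
  fixes S :: "'a::metric_space set" and f :: "'a \<Rightarrow> 'b::topological_space"
  assumes "compact S" "locally_one_to_one_map S f"
  obtains e where "e > 0"
    "\<And>x y. \<lbrakk>x \<in> S; y \<in> S; f x = f y; x \<noteq> y\<rbrakk> \<Longrightarrow> e \<le> dist x y"
proof -
  define \<G> where "\<G> = {U. open U \<and> inj_on f (S \<inter> U)}"
  have "S \<subseteq> \<Union>\<G>" "\<And>U. U \<in> \<G> \<Longrightarrow> open U"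
    using assms(2) unfolding \<G>_def locally_one_to_one_map_def by blast+
  with assms(1) obtain e where e: "e > 0" "\<And>x. x \<in> S \<Longrightarrow> \<exists>U\<in>\<G>. ball x e \<subseteq> U"
    by (metis Heine_Borel_lemma)
  have "e \<le> dist x y" if xy: "x \<in> S" "y \<in> S" "f x = f y" "x \<noteq> y" for x y
  proof (rule ccontr)
    assume "\<not> e \<le> dist x y"
    moreover obtain U where "U \<in> \<G>" "ball x e \<subseteq> U"
      using e(2) xy(1) by blast
    ultimately have "x \<in> S \<inter> U" "y \<in> S \<inter> U" "inj_on f (S \<inter> U)"
      using xy e(1) by (auto simp: \<G>_def)
    with xy(3,4) show False
      by (auto dest: inj_onD)
  qed
  with e(1) that show thesis by blast
qed

lemma eps_map_fibre_dist:
  assumes "bounded S" "eps_map e S g" "x \<in> S" "y \<in> S" "g x = g y"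
  shows "dist x y < e"
proof -
  let ?F = "{z \<in> S. g z = g y}"
  have "bounded ?F"
    using assms(1) by (rule bounded_subset) blast
  then have "dist x y \<le> diameter ?F"
    using assms(3-5) by (intro diameter_bounded_bound) auto
  also have "\<dots> < e"
    using assms(2,4) unfolding eps_map_def by blast
  finally show ?thesis .
qed

text \<open>
  The set \<open>Z\<close> below is a model inside the product \<open>Y \<times> \<real>\<close> of the space obtained from
  the disjoint sum of \<open>X\<close> and \<open>Y\<close> by gluing each \<open>x \<in> K\<close> to \<open>f x\<close>.  The distance from
  \<open>K\<close> vanishes exactly on \<open>K\<close>, so \<open>x \<mapsto> (f x, infdist x K)\<close> puts \<open>X - K\<close> bijectively
  above \<open>Y \<times> {0}\<close> and sends \<open>K\<close> into \<open>Y \<times> {0}\<close>; the retraction is the projection.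
\<close>

lemma two_to_one_retract_by_attaching:
  fixes X :: "'a::metric_space set" and f :: "'a \<Rightarrow> 'b::metric_space"
  assumes X: "continuum X" and f: "continuous_on X f"
    and K: "compact K" "K \<subseteq> X" "K \<noteq> {}"
    and bij: "bij_betw f (X - K) (f ` X)"
  shows "two_to_one_retract (f ` X)"
proof -
  define R where "R = (\<lambda>y. (y, 0::real)) ` f ` X"
  define h where "h = (\<lambda>x. (f x, infdist x K))"
  define Z where "Z = R \<union> h ` X"
  define r where "r = (\<lambda>p::'b \<times> real. (fst p, 0::real))"
  have "continuum (f ` X)"
    using X f unfolding continuum_def
    by (simp add: compact_continuous_image connected_continuous_image)
  moreover have homR: "homeomorphism R (f ` X) fst (\<lambda>y. (y, 0))"
    unfolding homeomorphism_def R_def by (auto intro!: continuous_intros simp: image_image)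
  ultimately have R: "continuum R"
    unfolding continuum_def R_def
    by (auto intro!: compact_continuous_image connected_continuous_image continuous_intros)
  have h: "continuous_on X h"
    unfolding h_def by (intro continuous_intros f)
  have zero: "infdist x K = 0 \<longleftrightarrow> x \<in> K" for x
    using K by (metis in_closed_iff_infdist_zero compact_imp_closed)
  have "continuum Z"
    unfolding continuum_def
  proof (intro conjI)
    show "Z \<noteq> {}" "compact Z"
      using R X h by (auto simp: Z_def continuum_def intro: compact_continuous_image compact_Un)
    \<comment> \<open>The two pieces of \<open>Z\<close> meet because \<open>K\<close> is nonempty.\<close>
    obtain k where "k \<in> K" using K(3) by blast
    then have "h k \<in> R \<inter> h ` X"
      using K(2) zero[of k] by (auto simp: h_def R_def)
    then show "connected Z"
      using R X connected_continuous_image[OF h]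
      unfolding Z_def continuum_def by (intro connected_Un) auto
  qed
  moreover note R
  moreover have "retraction Z R r"
    unfolding retraction_def r_def
    by (auto simp: Z_def R_def h_def intro!: continuous_intros)
  moreover have "two_to_one_on Z r"
    unfolding two_to_one_on_def
  proof
    fix q assume "q \<in> r ` Z"
    then have "\<exists>y \<in> f ` X. q = (y, 0)"
      by (auto simp: r_def Z_def R_def h_def)
    then obtain y where y: "y \<in> f ` X" "q = (y, 0)" by blast
    have "y \<in> f ` (X - K)"
      using bij y(1) by (simp add: bij_betw_def)
    then obtain w where w: "w \<in> X" "w \<notin> K" "f w = y" by blast
    have uniq: "z = w" if "z \<in> X" "z \<notin> K" "f z = y" for z
      using bij that w unfolding bij_betw_def by (auto dest: inj_onD)
    have on_K: "h x = (f x, 0)" if "x \<in> K" for x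
      using that zero[of x] by (simp add: h_def)
    have "{p \<in> Z. r p = q} = {(y, 0), h w}"
    proof (intro set_eqI iffI)
      fix p assume "p \<in> {p \<in> Z. r p = q}"
      then have p: "p \<in> Z" "fst p = y"
        using y(2) by (auto simp: r_def)
      then consider "p \<in> R" | x where "x \<in> X" "p = h x" "f x = y"
        by (auto simp: Z_def h_def)
      then show "p \<in> {(y, 0), h w}"
      proof cases
        case 1
        with p(2) show ?thesis by (auto simp: R_def)
      next
        case 2
        then show ?thesis
          using uniq[of x] on_K[of x] by (cases "x \<in> K") simp_all
      qed
    next
      fix p assume "p \<in> {(y, 0), h w}"
      moreover have "(y, 0) \<in> Z" "h w \<in> Z"
        using y(1) w(1) by (auto simp: Z_def R_def)
      moreover have "r (y, 0) = q" "r (h w) = q"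
        using y(2) w(3) by (simp_all add: r_def h_def)
      ultimately show "p \<in> {p \<in> Z. r p = q}" by blast
    qed
    moreover have "(y, 0) \<noteq> h w"
      using zero[of w] w(2) by (auto simp: h_def)
    ultimately show "card {p \<in> Z. r p = q} = 2"
      by simp
  qed
  moreover have "R homeomorphic f ` X"
    using homR homeomorphic_def by blast
  ultimately show ?thesis
    by (rule two_to_one_retractI)
qed

theorem theorem3:
  fixes X :: "'a::metric_space set" and Y :: "'b::metric_space set" and f :: "'a \<Rightarrow> 'b"
  assumes "arc_like X"
    and "continuum Y"
    and "strictly_locally_one_to_one_map X f"
    and "f ` X = Y"
  shows "two_to_one_retract Y"
proof -
  have X: "continuum X" and comp: "compact X"
    using assms(1) by (auto simp: arc_like_def continuum_def)
  have loc: "locally_one_to_one_map X f" and f: "continuous_on X f"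
    using assms(3)
    by (auto simp: strictly_locally_one_to_one_map_def locally_one_to_one_map_def)
  obtain e where e: "e > 0"
    and sep: "\<And>x y. \<lbrakk>x \<in> X; y \<in> X; f x = f y; x \<noteq> y\<rbrakk> \<Longrightarrow> e \<le> dist x y"
    using separated_fibres_if_locally_one_to_one[OF comp loc] by blast
  obtain g :: "'a \<Rightarrow> real" where eps: "eps_map e X g"
    using assms(1) e unfolding arc_like_def by blast
  then have g: "continuous_on X g" by (simp add: eps_map_def)
  have close: "dist x y < e" if "x \<in> X" "y \<in> X" "g x = g y" for x y
    using eps_map_fibre_dist[OF compact_imp_bounded[OF comp] eps that] .
  have inj_g: "x = y" if "x \<in> X" "y \<in> X" "f x = f y" "g x = g y" for x y
    using sep[of x y] close[of x y] that by force
  define K where "K = {x \<in> X. \<exists>x'\<in>X. f x' = f x \<and> g x' < g x}"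

  \<comment> \<open>The condition \<open>g x' < g x\<close> is replaced by closed ones: a pair with \<open>g x' = g x\<close> is
    excluded by the lower bound on the distance.\<close>
  define P where "P = {p \<in> X \<times> X. f (fst p) = f (snd p) \<and> g (snd p) \<le> g (fst p)
    \<and> e \<le> dist (fst p) (snd p)}"
  have K_eq: "K = fst ` P"
  proof (intro set_eqI iffI)
    fix x assume "x \<in> K"
    then obtain x' where x': "x \<in> X" "x' \<in> X" "f x' = f x" "g x' < g x"
      by (auto simp: K_def)
    then have "(x, x') \<in> P"
      using sep[of x x'] by (auto simp: P_def)
    then show "x \<in> fst ` P" by force
  next
    fix x assume "x \<in> fst ` P"
    then obtain x' where x': "x \<in> X" "x' \<in> X" "f x = f x'" "g x' \<le> g x" "e \<le> dist x x'"
      by (auto simp: P_def)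
    then have "g x' \<noteq> g x"
      using close[of x x'] by force
    with x' show "x \<in> K"
      unfolding K_def by force
  qed
  have XX: "compact (X \<times> X)"
    using comp by (intro compact_Times)
  have f2: "continuous_on (X \<times> X) (\<lambda>p. f (fst p))" "continuous_on (X \<times> X) (\<lambda>p. f (snd p))"
    and g2: "continuous_on (X \<times> X) (\<lambda>p. g (fst p))" "continuous_on (X \<times> X) (\<lambda>p. g (snd p))"
    by (auto intro!: continuous_on_compose2[OF f] continuous_on_compose2[OF g] continuous_intros)
  note closed_le = continuous_on_closed_Collect_le[OF _ _ compact_imp_closed[OF XX]]
  have "closed {p \<in> X \<times> X. dist (f (fst p)) (f (snd p)) \<le> 0}"
    by (rule closed_le[OF continuous_on_dist[OF f2] continuous_on_const])
  moreover have "closed {p \<in> X \<times> X. g (snd p) \<le> g (fst p)}"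
    by (rule closed_le[OF g2(2) g2(1)])
  moreover have "closed {p \<in> X \<times> X. e \<le> dist (fst p) (snd p)}"
    by (rule closed_le[OF continuous_on_const
          continuous_on_dist[OF continuous_on_fst continuous_on_snd]]) (rule continuous_on_id)+
  ultimately have "closed ({p \<in> X \<times> X. dist (f (fst p)) (f (snd p)) \<le> 0} \<inter>
      {p \<in> X \<times> X. g (snd p) \<le> g (fst p)} \<inter> {p \<in> X \<times> X. e \<le> dist (fst p) (snd p)})"
    by (simp only: closed_Int)
  also have "\<dots> = P"
    by (auto simp: P_def)
  finally have "closed P" .
  then have "compact ((X \<times> X) \<inter> P)"
    using XX by (intro compact_Int_closed)
  moreover have "(X \<times> X) \<inter> P = P" by (auto simp: P_def)
  ultimately have compK: "compact K"
    unfolding K_eq by (auto intro!: compact_continuous_image continuous_intros)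

  have "\<not> inj_on f X"
    using assms(3) homeomorphism_compact[OF comp f refl]
    unfolding strictly_locally_one_to_one_map_def by blast
  then obtain x y where xy: "x \<in> X" "y \<in> X" "f x = f y" "x \<noteq> y"
    unfolding inj_on_def by blast
  then have "g x < g y \<or> g y < g x"
    using inj_g by force
  then have "x \<in> K \<or> y \<in> K"
    using xy unfolding K_def by auto
  then have neK: "K \<noteq> {}" by blast

  have "inj_on f (X - K)"
  proof (rule inj_onI)
    fix x y assume "x \<in> X - K" "y \<in> X - K" "f x = f y"
    then have "\<not> g x < g y" "\<not> g y < g x" "x \<in> X" "y \<in> X"
      by (auto simp: K_def)
    with \<open>f x = f y\<close> show "x = y" using inj_g by force
  qed
  moreover have "f x \<in> f ` (X - K)" if "x \<in> X" for x
  proof -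
    let ?F = "{z \<in> X. f z \<in> {f x}}"
    have "closed ?F"
      using continuous_closed_preimage[OF f compact_imp_closed[OF comp] closed_singleton[of "f x"]]
      by (simp add: vimage_def Int_def)
    then have "compact (X \<inter> ?F)"
      using comp by (intro compact_Int_closed)
    moreover have "X \<inter> ?F = ?F" by blast
    ultimately have "compact ?F" by simp
    moreover have "?F \<noteq> {}" using that by blast
    moreover have "continuous_on ?F g"
      using g by (rule continuous_on_subset) blast
    ultimately obtain w where w: "w \<in> ?F" "\<forall>z\<in>?F. g w \<le> g z"
      using continuous_attains_inf by blast
    then have "\<not> g z < g w" if "z \<in> X" "f z = f w" for z
      using that by (simp add: not_less)
    with w(1) have "w \<in> X - K" "f w = f x"
      by (auto simp: K_def)
    then show ?thesis by (metis imageI)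
  qed
  ultimately have "bij_betw f (X - K) (f ` X)"
    unfolding bij_betw_def by blast
  moreover have "K \<subseteq> X" by (auto simp: K_def)
  ultimately have "two_to_one_retract (f ` X)"
    using two_to_one_retract_by_attaching[OF X f compK _ neK] by blast
  then show ?thesis by (simp add: assms(4))
qed

end
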